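(* Let $\lambda \in \mathbb{C}$, $\lambda\ne 0$, $\lambda \notin (0,+\infty)$, and let $$\beta_{n}(z;\lambda) = (-1)^{n-1} \frac{(\log \lambda)^{n}}{n!} \lambda^{z} \mathcal{B}_{n}(z;\lambda).$$ Let $\epsilon = \pm 1$ be the sign of $\operatorname{Im} \lambda$ when $\lambda \notin \mathbb{R}$, and $\epsilon = 1$ when $\lambda \in (-\infty,0)$. Then, for $z$ in any compact subset $K$ of $\mathbb{C}$, $\beta_{n}(z;\lambda) \neq 1$ for all sufficiently large $n$ (depending on $K$), and $$\frac{\beta_{n+1}(z;\lambda) - 1}{\beta_{n}(z;\lambda) - 1} = \frac{1}{1 - \epsilon\frac{2\pi i}{\log\lambda}} + O\left( \left| \frac{1 - \epsilon\frac{2\pi i}{\log\lambda}}{1 + \epsilon\frac{2\pi i}{\log\lambda}} \right|^{n} \right), \qquad n \to \infty,$$ uniformly for $z \in K$. In particular $$\lim_{n\to\infty} \frac{\beta_{n+1}(z;\lambda) - 1}{\beta_{n}(z;\lambda) - 1} = \frac{1}{1 - \epsilon\frac{2\pi i}{\log\lambda}}$$ uniformly on compact subsets of $\mathbb{C}$.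
   Context: The Apostol-Bernoulli polynomials $\mathcal{B}_n(x;\lambda)$ ($n\ge 0$, $\lambda\in\mathbb{C}$) are defined by the power series expansion at $z=0$ $$\frac{z e^{xz}}{\lambda e^z-1} = \sum_{n=0}^\infty \mathcal{B}_n(x;\lambda)\, \frac{z^n}{n!}.$$ $\log$ denotes the principal branch, $\log\lambda = \log|\lambda| + i\arg\lambda$ with $-\pi<\arg\lambda\le\pi$, and $\lambda^z = e^{z\log\lambda}$. *)

theory Defs
  imports "HOL-Complex_Analysis.Complex_Analysis"
begin

text \<open>
  The quotient is that of formal power series, so \<open>lam = 1\<close> (numerator and denominator both
  divisible by \<open>X\<close>) is covered as well. The lemma below connects it with the expansion
  of the analytic function at 0.
\<close>
definition apostol_bernoulli :: "nat \<Rightarrow> complex \<Rightarrow> complex \<Rightarrow> complex" where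
  "apostol_bernoulli n x lam =
     fact n * fps_nth (fps_X * fps_exp x / (fps_const lam * fps_exp 1 - 1)) n"

lemma apostol_bernoulli_expansion:
  "(\<lambda>z. z * exp (x * z) / (lam * exp z - 1)) has_laurent_expansion
     fps_to_fls (Abs_fps (\<lambda>n. apostol_bernoulli n x lam / fact n))"
proof -
  define D :: "complex fps" where "D = fps_const lam * fps_exp 1 - 1"
  define N :: "complex fps" where "N = fps_X * fps_exp x"
  have D: "(\<lambda>z. lam * exp z - 1) has_fps_expansion D"
    unfolding D_def by (intro fps_expansion_intros)
  have N: "(\<lambda>z. z * exp (x * z)) has_fps_expansion N"
    unfolding N_def by (intro fps_expansion_intros)
  have 1: "fps_nth D 1 = lam" and 0: "fps_nth D 0 = lam - 1"
    by (simp_all add: D_def)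
  have "subdegree D \<le> 1"
  proof (cases "lam = 0")
    case True
    then have "subdegree D \<le> 0" using 0 by (intro subdegree_leI) simp
    then show ?thesis by simp
  next
    case False
    then show ?thesis using 1 by (intro subdegree_leI) simp
  qed
  also have "1 \<le> subdegree N"
  proof (rule subdegree_geI)
    have "fps_nth N 1 = 1" by (simp add: N_def)
    then show "N \<noteq> 0" by auto
  qed (simp add: N_def)
  finally have "fps_to_fls (N / D) = fps_to_fls N / fps_to_fls D"
    by (rule fls_divide_fps_to_fls [symmetric])
  moreover have "Abs_fps (\<lambda>n. apostol_bernoulli n x lam / fact n) = N / D"
    by (simp add: fps_eq_iff apostol_bernoulli_def N_def D_def)
  moreover have "(\<lambda>z. z * exp (x * z) / (lam * exp z - 1)) has_laurent_expansion
      fps_to_fls N / fps_to_fls D"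
    by (intro has_laurent_expansion_divide has_laurent_expansion_fps N D)
  ultimately show ?thesis by simp
qed

text \<open>
  The library's \<open>Ln\<close> is the principal branch with argument in \<open>(-pi, pi]\<close>, and
  \<open>lam powr z = exp (z * Ln lam)\<close> for \<open>lam \<noteq> 0\<close>.
\<close>
definition beta_ab :: "nat \<Rightarrow> complex \<Rightarrow> complex \<Rightarrow> complex" where
  "beta_ab n z lam =
     (-1) powi (int n - 1) * (Ln lam ^ n / fact n) * lam powr z * apostol_bernoulli n z lam"

end

theory Submission imports Defs begin

text \<open>
  The generating function \<open>w exp (x w) / (lam exp w - 1)\<close> has simple poles exactly at
  \<open>p k = 2 pi i k - Ln lam\<close> with \<open>k\<close> an integer, and its Taylor coefficients at 0 are governed
  by the poles nearest to 0. Integrating it against \<open>1 / w ^ (n + 1)\<close> over a circle of radius \<open>r\<close>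
  and collecting residues gives
  \<open>apostol_bernoulli n x lam / n! = - (\<Sum>k. exp (x p k) / p k ^ n) + O(1 / r ^ n)\<close>, the sum running
  over the poles inside the circle. Multiplied by the prefactor of \<open>beta_ab\<close>, the pole \<open>p k\<close>
  contributes \<open>exp (2 pi i k z) * q k ^ n\<close> with \<open>q k = 1 / (1 - 2 pi i k / Ln lam)\<close>
  (\<open>beta_ab_expansion\<close>). The pole \<open>p 0\<close> contributes exactly 1, which is what the theorem subtracts.

  What is left is a question of which of the remaining poles is closest to 0. All of them lie on the
  vertical line of real part \<open>- Re (Ln lam)\<close>, so only heights matter. Put \<open>t = eps * Im (Ln lam)\<close>;
  the choice of \<open>eps\<close> and \<open>lam \<notin> (0,\<infinity>)\<close> give \<open>0 < t \<le> pi\<close>, and the height of \<open>p (eps j)\<close> is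
  \<open>\<bar>2 pi j - t\<bar>\<close>. For \<open>j = 1\<close> this is \<open>2 pi - t\<close>, strictly less than the height
  \<open>2 pi + t\<close> of \<open>j = - 1\<close>, which in turn is at most the height \<open>4 pi - t\<close> of \<open>j = 2\<close>, with equality
  for negative \<open>lam\<close>. Hence
  \<open>beta_ab n z lam - 1 = exp (2 pi i eps z) * q eps ^ n + O(\<bar>q (- eps)\<bar> ^ n)\<close> uniformly on compact sets.
  The exponential factor is bounded away from 0 there, so quotients of consecutive terms converge
  geometrically to \<open>q eps\<close> (\<open>dominant_geometric_term_ratio\<close>), with rate
  \<open>\<bar>q (- eps) / q eps\<bar>\<close>.
\<close>

section \<open>Poles and residues of the generating function\<close>

definition ab_pole :: "complex \<Rightarrow> int \<Rightarrow> complex" where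
  "ab_pole lam k = of_int k * (2 * of_real pi * \<i>) - Ln lam"

lemma ab_pole_iff:
  assumes "lam \<noteq> 0"
  shows "lam * exp w = 1 \<longleftrightarrow> (\<exists>k. w = ab_pole lam k)"
proof -
  have "lam * exp w = 1 \<longleftrightarrow> exp w = exp (- Ln lam)"
    using assms by (simp add: exp_minus field_simps)
  also have "\<dots> \<longleftrightarrow> (\<exists>k. w = ab_pole lam k)"
    unfolding exp_eq ab_pole_def by (simp add: algebra_simps)
  finally show ?thesis .
qed

lemma inj_ab_pole: "inj (ab_pole lam)"
  by (auto simp: inj_on_def ab_pole_def)

lemma ab_pole_nonzero:
  assumes "lam \<noteq> 0" "lam \<noteq> 1"
  shows "ab_pole lam k \<noteq> 0"
  using ab_pole_iff[OF assms(1), of "ab_pole lam k"] assms(2) by auto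

lemma residue_ab_origin:
  assumes "lam \<noteq> 1"
  shows "residue (\<lambda>w. (w * exp (x * w) / (lam * exp w - 1)) / w ^ Suc n) 0
           = apostol_bernoulli n x lam / fact n"
proof -
  have "(\<lambda>w. w * exp (x * w) / (lam * exp w - 1)) has_fps_expansion
      (fps_X * fps_exp x / (fps_const lam * fps_exp 1 - 1))"
    using assms by (intro fps_expansion_intros has_fps_expansion_divide') auto
  then show ?thesis
    by (subst residue_fps_expansion_over_power_at_0) (auto simp: apostol_bernoulli_def)
qed

text \<open>
  At a pole \<open>p\<close> the denominator has derivative \<open>lam * exp p = 1\<close>, so the residue is just the value of
  the numerator.
\<close>
lemma residue_ab_pole:
  fixes k :: int
  assumes "lam \<noteq> 0" "lam \<noteq> 1"
  defines "p \<equiv> ab_pole lam k"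
  shows "residue (\<lambda>w. (w * exp (x * w) / (lam * exp w - 1)) / w ^ Suc n) p
           = exp (x * p) / p ^ n"
proof -
  have p0: "p \<noteq> 0" using ab_pole_nonzero assms by auto
  have p1: "lam * exp p = 1" using ab_pole_iff assms by auto
  have "residue (\<lambda>w. (w * exp (x * w) / w ^ Suc n) / (lam * exp w - 1)) p
      = (p * exp (x * p) / p ^ Suc n) / (lam * exp p)"
  proof (rule residue_simple_pole_deriv)
    show "(\<lambda>w. w * exp (x * w) / w ^ Suc n) holomorphic_on ball p (norm p)"
      by (intro holomorphic_intros) auto
    show "(\<lambda>w. lam * exp w - 1) holomorphic_on ball p (norm p)"
      by (intro holomorphic_intros)
    show "((\<lambda>w. lam * exp w - 1) has_field_derivative lam * exp p) (at p)"
      by (auto intro!: derivative_eq_intros)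
  qed (use p0 p1 in auto)
  also have "(\<lambda>w. (w * exp (x * w) / w ^ Suc n) / (lam * exp w - 1))
      = (\<lambda>w. (w * exp (x * w) / (lam * exp w - 1)) / w ^ Suc n)"
    by (simp only: divide_divide_eq_left mult.commute)
  finally show ?thesis using p0 p1 by simp
qed

text \<open>
  The annulus free of poles between the radii \<open>r\<close> and \<open>r'\<close> leaves room for a ball in which the
  circle of radius \<open>r\<close> is contained and only finitely many singularities occur, as the residue
  theorem demands.
\<close>
lemma apostol_bernoulli_residue_sum:
  assumes lam: "lam \<noteq> 0" "lam \<noteq> 1"
    and r: "0 < r" "r < r'"
    and S: "finite S" "\<And>k. k \<in> S \<Longrightarrow> norm (ab_pole lam k) < r"
      "\<And>k. k \<notin> S \<Longrightarrow> r' \<le> norm (ab_pole lam k)"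
  shows "contour_integral (circlepath 0 r)
           (\<lambda>w. (w * exp (x * w) / (lam * exp w - 1)) / w ^ Suc n)
         = 2 * of_real pi * \<i> * (apostol_bernoulli n x lam / fact n
             + (\<Sum>k\<in>S. exp (x * ab_pole lam k) / ab_pole lam k ^ n))"
proof -
  let ?F = "\<lambda>w. (w * exp (x * w) / (lam * exp w - 1)) / w ^ Suc n"
  define pts where "pts = insert 0 (ab_pole lam ` S)"
  have sub: "norm p < r" if "p \<in> pts" for p
    using that r S unfolding pts_def by auto
  have "contour_integral (circlepath 0 r) ?F =
      2 * pi * \<i> * (\<Sum>p\<in>pts. winding_number (circlepath 0 r) p * residue ?F p)"
  proof (rule Residue_theorem)
    show "?F holomorphic_on ball 0 r' - pts"
    proof (intro holomorphic_intros)
      fix w assume w: "w \<in> ball 0 r' - pts"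
      show "lam * exp w - 1 \<noteq> 0"
      proof
        assume "lam * exp w - 1 = 0"
        then obtain k where "w = ab_pole lam k" using ab_pole_iff[OF lam(1)] by auto
        with w S(3)[of k] show False by (force simp: pts_def)
      qed
      show "w ^ Suc n \<noteq> 0" using w by (auto simp: pts_def)
    qed
    show "path_image (circlepath 0 r) \<subseteq> ball 0 r' - pts"
      using r sub by fastforce
    show "\<forall>z. z \<notin> ball 0 r' \<longrightarrow> winding_number (circlepath 0 r) z = 0"
      using r by (intro allI impI winding_number_zero_outside[of _ "ball 0 r'"]) auto
  qed (use S in \<open>auto simp: pts_def\<close>)
  also have "(\<Sum>p\<in>pts. winding_number (circlepath 0 r) p * residue ?F p) = (\<Sum>p\<in>pts. residue ?F p)"
    by (intro sum.cong refl) (simp add: winding_number_circlepath sub)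
  also have "\<dots> = residue ?F 0 + (\<Sum>p\<in>ab_pole lam ` S. residue ?F p)"
    unfolding pts_def using S(1) ab_pole_nonzero[OF lam] by (subst sum.insert) fastforce+
  also have "(\<Sum>p\<in>ab_pole lam ` S. residue ?F p) =
      (\<Sum>k\<in>S. exp (x * ab_pole lam k) / ab_pole lam k ^ n)"
    by (subst sum.reindex[OF inj_on_subset[OF inj_ab_pole]])
      (simp_all only: o_def residue_ab_pole[OF lam] subset_UNIV)
  finally show ?thesis by (simp only: residue_ab_origin[OF lam(2)] of_real_mult of_real_numeral)
qed

text \<open>
  On the circle the denominator is bounded below independently of \<open>x\<close>, since \<open>x\<close> enters only
  through \<open>exp (x * w)\<close>, which is at most \<open>exp (X * r)\<close> in modulus; this makes the estimate uniform
  for bounded \<open>x\<close>.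
\<close>
lemma apostol_bernoulli_pole_sum_bound:
  assumes lam: "lam \<noteq> 0" "lam \<noteq> 1"
    and r: "0 < r" "r < r'"
    and S: "finite S" "\<And>k. k \<in> S \<Longrightarrow> norm (ab_pole lam k) < r"
      "\<And>k. k \<notin> S \<Longrightarrow> r' \<le> norm (ab_pole lam k)"
  shows "\<exists>M\<ge>0. \<forall>n (x::complex). norm x \<le> X \<longrightarrow>
           norm (apostol_bernoulli n x lam / fact n
             + (\<Sum>k\<in>S. exp (x * ab_pole lam k) / ab_pole lam k ^ n)) \<le> M / r ^ n"
proof -
  have nz: "lam * exp w - 1 \<noteq> 0" if "norm w = r" for w
  proof
    assume "lam * exp w - 1 = 0"
    then obtain k where "w = ab_pole lam k" using ab_pole_iff[OF lam(1)] by auto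
    with that S(2,3)[of k] r show False by (cases "k \<in> S") auto
  qed
  have "\<exists>w0\<in>sphere 0 r. \<forall>w\<in>sphere 0 r. norm (lam * exp w0 - 1) \<le> norm (lam * exp w - 1)"
    using r by (intro continuous_attains_inf continuous_intros) auto
  then obtain m where m: "m > 0" "\<And>w. norm w = r \<Longrightarrow> m \<le> norm (lam * exp w - 1)"
    using nz by (metis dist_0_norm mem_sphere zero_less_norm_iff)
  define M where "M = r * exp (X * r) / m"
  show ?thesis
  proof (intro exI conjI allI impI)
    show "M \<ge> 0" using m r by (simp add: M_def)
    fix n and x :: complex assume x: "norm x \<le> X"
    let ?F = "\<lambda>w. (w * exp (x * w) / (lam * exp w - 1)) / w ^ Suc n"
    let ?s = "apostol_bernoulli n x lam / fact n
             + (\<Sum>k\<in>S. exp (x * ab_pole lam k) / ab_pole lam k ^ n)"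
    have int: "?F contour_integrable_on circlepath 0 r"
    proof (rule contour_integrable_continuous_circlepath)
      show "continuous_on (path_image (circlepath 0 r)) ?F"
        using r nz by (intro continuous_intros) auto
    qed
    have bnd: "norm (?F w) \<le> exp (X * r) / m / r ^ n" if w: "norm (w - 0) = r" for w
    proof -
      have "norm (exp (x * w)) \<le> exp (norm (x * w))" by (rule norm_exp)
      also have "\<dots> \<le> exp (X * r)" using w x r by (simp add: norm_mult mult_right_mono)
      finally have 1: "norm (exp (x * w)) \<le> exp (X * r)" .
      have "norm (?F w) = norm (exp (x * w)) / norm (lam * exp w - 1) / r ^ n"
        using w r by (auto simp add: norm_divide norm_mult norm_power simp del: norm_exp_eq_Re)
      also have "\<dots> \<le> exp (X * r) / m / r ^ n"
        using 1 m w r by (intro divide_right_mono frac_le) auto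
      finally show ?thesis .
    qed
    have "norm (contour_integral (circlepath 0 r) ?F) \<le> exp (X * r) / m / r ^ n * (2 * pi * r)"
      by (rule has_contour_integral_bound_circlepath[OF has_contour_integral_integral[OF int] _ r(1) bnd])
        (use m r in auto)
    moreover have "contour_integral (circlepath 0 r) ?F = 2 * of_real pi * \<i> * ?s"
      by (rule apostol_bernoulli_residue_sum[OF lam r S])
    then have "norm (contour_integral (circlepath 0 r) ?F) = 2 * pi * norm ?s"
      by (simp only: norm_mult) simp
    ultimately have "2 * pi * norm ?s \<le> 2 * pi * (M / r ^ n)"
      by (simp add: M_def field_simps)
    then show "norm ?s \<le> M / r ^ n" by (subst (asm) mult_le_cancel_left_pos) auto
  qed
qed

section \<open>Expansion of the normalised polynomials in geometric sequences\<close>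

definition ab_ratio :: "complex \<Rightarrow> int \<Rightarrow> complex" where
  "ab_ratio lam k = 1 / (1 - of_int k * (2 * of_real pi * \<i> / Ln lam))"

lemma ab_ratio_eq:
  assumes "lam \<noteq> 0" "lam \<noteq> 1"
  shows "ab_ratio lam k = - Ln lam / ab_pole lam k"
proof -
  have "Ln lam \<noteq> 0" using assms by (metis Ln_1 exp_Ln exp_zero)
  moreover have "ab_pole lam k \<noteq> 0" using ab_pole_nonzero[OF assms] .
  moreover have "1 - of_int k * (2 * of_real pi * \<i> / Ln lam) = - (ab_pole lam k / Ln lam)"
    using \<open>Ln lam \<noteq> 0\<close> by (simp add: ab_pole_def field_simps)
  ultimately show ?thesis by (simp add: ab_ratio_def)
qed

text \<open>
  The prefactor is chosen to cancel the logarithm in each pole: \<open>lam powr z * exp (z * p k)\<close> is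
  \<open>exp (2 pi i k z)\<close>, and \<open>- Ln lam / p k\<close> is \<open>ab_ratio lam k\<close>.
\<close>
lemma beta_ab_expansion:
  assumes lam: "lam \<noteq> 0" "lam \<noteq> 1"
    and r: "0 < r" "r < r'"
    and S: "finite S" "\<And>k. k \<in> S \<Longrightarrow> norm (ab_pole lam k) < r"
      "\<And>k. k \<notin> S \<Longrightarrow> r' \<le> norm (ab_pole lam k)"
    and K: "bounded K"
  shows "\<exists>C\<ge>0. \<forall>n. \<forall>z\<in>K.
           norm (beta_ab n z lam
             - (\<Sum>k\<in>S. exp (of_int k * (2 * of_real pi * \<i>) * z) * ab_ratio lam k ^ n))
           \<le> C * (norm (Ln lam) / r) ^ n"
proof -
  obtain X where X: "\<And>z. z \<in> K \<Longrightarrow> norm z \<le> X"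
    using K by (auto simp: bounded_iff)
  obtain M where M: "M \<ge> 0" "\<And>n x. norm x \<le> X \<Longrightarrow>
           norm (apostol_bernoulli n x lam / fact n
             + (\<Sum>k\<in>S. exp (x * ab_pole lam k) / ab_pole lam k ^ n)) \<le> M / r ^ n"
    using apostol_bernoulli_pole_sum_bound[OF lam r S] by metis
  show ?thesis
  proof (intro exI conjI allI ballI)
    show "exp (X * norm (Ln lam)) * M \<ge> 0" using M by simp
    fix n z assume z: "z \<in> K"
    let ?s = "apostol_bernoulli n z lam / fact n
             + (\<Sum>k\<in>S. exp (z * ab_pole lam k) / ab_pole lam k ^ n)"
    have sgn: "(-1::complex) powi (int n - 1) = - ((-1) ^ n)"
      by (simp add: power_int_diff)
    have summand: "(- Ln lam) ^ n * (lam powr z * (exp (z * ab_pole lam k) / ab_pole lam k ^ n))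
        = exp (of_int k * (2 * of_real pi * \<i>) * z) * ab_ratio lam k ^ n" for k
    proof -
      have "lam powr z * exp (z * ab_pole lam k) = exp (of_int k * (2 * of_real pi * \<i>) * z)"
        using lam by (simp add: powr_def ab_pole_def flip: exp_add) (simp add: algebra_simps)
      then show ?thesis unfolding ab_ratio_eq[OF lam] power_divide by (simp add: mult_ac)
    qed
    have "beta_ab n z lam = - ((- Ln lam) ^ n * (lam powr z * (apostol_bernoulli n z lam / fact n)))"
      by (simp add: beta_ab_def sgn power_minus[of "Ln lam"])
    then have "beta_ab n z lam
        - (\<Sum>k\<in>S. exp (of_int k * (2 * of_real pi * \<i>) * z) * ab_ratio lam k ^ n)
        = - ((- Ln lam) ^ n * (lam powr z * ?s))"
      unfolding summand[symmetric] by (simp add: distrib_left sum_distrib_left)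
    then have "norm (beta_ab n z lam
        - (\<Sum>k\<in>S. exp (of_int k * (2 * of_real pi * \<i>) * z) * ab_ratio lam k ^ n))
        = norm (Ln lam) ^ n * (norm (lam powr z) * norm ?s)"
      by (simp add: norm_mult norm_power)
    also have "\<dots> \<le> norm (Ln lam) ^ n * (exp (X * norm (Ln lam)) * (M / r ^ n))"
    proof (intro mult_left_mono mult_mono)
      have "norm (lam powr z) \<le> exp (norm (z * Ln lam))"
        using lam norm_exp[of "z * Ln lam"] by (simp add: powr_def)
      also have "\<dots> \<le> exp (X * norm (Ln lam))"
        using X[OF z] by (simp add: norm_mult mult_right_mono)
      finally show "norm (lam powr z) \<le> exp (X * norm (Ln lam))" .
      show "norm ?s \<le> M / r ^ n" by (rule M(2)[OF X[OF z]])
    qed auto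
    also have "\<dots> = exp (X * norm (Ln lam)) * M * (norm (Ln lam) / r) ^ n"
      by (simp add: power_divide)
    finally show "norm (beta_ab n z lam
        - (\<Sum>k\<in>S. exp (of_int k * (2 * of_real pi * \<i>) * z) * ab_ratio lam k ^ n))
        \<le> exp (X * norm (Ln lam)) * M * (norm (Ln lam) / r) ^ n" .
  qed
qed

section \<open>Consecutive quotients of a dominated geometric sequence\<close>

text \<open>
  In \<open>f (n + 1) - q * f n\<close> the dominant terms cancel, leaving \<open>O(r ^ n)\<close>, while \<open>f n\<close> itself is
  eventually at least half as large as \<open>c * \<bar>q\<bar> ^ n\<close>.
\<close>
lemma dominant_geometric_term_ratio:
  fixes f :: "nat \<Rightarrow> 'a \<Rightarrow> complex" and u :: "'a \<Rightarrow> complex" and q :: complex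
  assumes r: "0 \<le> r" "r < norm q"
    and u: "0 < c" "\<And>z. z \<in> K \<Longrightarrow> c \<le> norm (u z)"
    and C: "0 \<le> C"
    and f: "\<And>n z. z \<in> K \<Longrightarrow> norm (f n z - u z * q ^ n) \<le> C * r ^ n"
  shows "\<forall>\<^sub>F n in sequentially. \<forall>z\<in>K. f n z \<noteq> 0"
    and "\<exists>D. \<forall>\<^sub>F n in sequentially. \<forall>z\<in>K. norm (f (Suc n) z / f n z - q) \<le> D * (r / norm q) ^ n"
proof -
  have q: "norm q > 0" using r by linarith
  have "(\<lambda>n. C * (r / norm q) ^ n) \<longlonglongrightarrow> C * 0"
    using r q by (intro tendsto_intros LIMSEQ_realpow_zero) auto
  then have "\<forall>\<^sub>F n in sequentially. C * (r / norm q) ^ n < c / 2"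
    using u by (intro order_tendstoD) auto
  then have low: "\<forall>\<^sub>F n in sequentially. \<forall>z\<in>K. c / 2 * norm q ^ n \<le> norm (f n z)"
  proof eventually_elim
    case (elim n)
    show ?case
    proof
      fix z assume z: "z \<in> K"
      have "C * r ^ n = C * (r / norm q) ^ n * norm q ^ n"
        using q by (simp add: power_divide)
      also have "\<dots> \<le> c / 2 * norm q ^ n"
        using elim by (intro mult_right_mono) auto
      finally have 1: "C * r ^ n \<le> c / 2 * norm q ^ n" .
      have 2: "c * norm q ^ n \<le> norm (u z * q ^ n)"
        using u(2)[OF z] by (simp add: norm_mult norm_power mult_right_mono)
      have "norm (u z * q ^ n) \<le> norm (f n z) + norm (f n z - u z * q ^ n)"
        by (metis norm_minus_commute norm_triangle_sub)
      with f[OF z, of n] 1 2 show "c / 2 * norm q ^ n \<le> norm (f n z)" by simp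
    qed
  qed
  then show "\<forall>\<^sub>F n in sequentially. \<forall>z\<in>K. f n z \<noteq> 0"
  proof eventually_elim
    case (elim n)
    have "c / 2 * norm q ^ n > 0" using u q by simp
    with elim show ?case by fastforce
  qed
  show "\<exists>D. \<forall>\<^sub>F n in sequentially. \<forall>z\<in>K. norm (f (Suc n) z / f n z - q) \<le> D * (r / norm q) ^ n"
  proof (rule exI[of _ "C * (r + norm q) / (c / 2)"], use low in \<open>rule eventually_mono\<close>)
    fix n assume low_n: "\<forall>z\<in>K. c / 2 * norm q ^ n \<le> norm (f n z)"
    show "\<forall>z\<in>K. norm (f (Suc n) z / f n z - q)
        \<le> (C * (r + norm q) / (c / 2)) * (r / norm q) ^ n"
    proof
      fix z assume z: "z \<in> K"
      have l: "c / 2 * norm q ^ n \<le> norm (f n z)" using low_n z by blast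
      have l0: "c / 2 * norm q ^ n > 0" using u q by simp
      have fz: "f n z \<noteq> 0" using l l0 by auto
      have "f (Suc n) z - q * f n z
          = (f (Suc n) z - u z * q ^ Suc n) - q * (f n z - u z * q ^ n)"
        by (simp add: algebra_simps)
      also have "norm \<dots> \<le> C * r ^ Suc n + norm q * (C * r ^ n)"
        by (rule order_trans[OF norm_triangle_ineq4], unfold norm_mult[of q])
          (intro add_mono mult_left_mono f z norm_ge_zero)
      also have "\<dots> = C * (r + norm q) * r ^ n" by (simp add: algebra_simps)
      finally have num: "norm (f (Suc n) z - q * f n z) \<le> C * (r + norm q) * r ^ n" .
      have "norm (f (Suc n) z / f n z - q) = norm (f (Suc n) z - q * f n z) / norm (f n z)"
        using fz by (simp add: field_simps flip: norm_divide)
      also have "\<dots> \<le> (C * (r + norm q) * r ^ n) / (c / 2 * norm q ^ n)"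
        using num l l0 r C by (intro frac_le) (auto intro!: mult_nonneg_nonneg)
      also have "\<dots> = (C * (r + norm q) / (c / 2)) * (r / norm q) ^ n"
        by (simp add: power_divide)
      finally show "norm (f (Suc n) z / f n z - q) \<le> (C * (r + norm q) / (c / 2)) * (r / norm q) ^ n" .
    qed
  qed
qed

section \<open>The order of the poles by modulus\<close>

text \<open>
  Indexing by \<open>e * j\<close> reflects the lower half-plane case to the upper one, so that both
  signs are treated with the same inequalities.
\<close>
lemma norm_ab_pole:
  assumes "e = 1 \<or> e = -1"
  shows "norm (ab_pole lam (e * j)) = sqrt (Re (Ln lam) ^ 2 + (2 * pi * j - e * Im (Ln lam)) ^ 2)"
proof -
  have "(2 * pi * (e * j) - Im (Ln lam))\<^sup>2 = (2 * pi * j - e * Im (Ln lam)) ^ 2"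
    using assms by (auto simp: power2_eq_square algebra_simps)
  then show ?thesis by (simp add: cmod_def ab_pole_def mult_ac del: Re_Ln)
qed

lemma sign_Im_Ln:
  assumes "lam \<noteq> 0" and "lam \<notin> complex_of_real ` {0<..}"
    and "eps = (if lam \<in> \<real> then 1 else sgn (Im lam))"
  obtains e :: int where "e = 1 \<or> e = -1" "eps = of_int e"
    "0 < e * Im (Ln lam)" "e * Im (Ln lam) \<le> pi"
proof (cases "lam \<in> \<real>")
  case True
  then obtain x where x: "lam = of_real x" by (auto simp: Reals_def)
  then have "x < 0" using assms(1,2) by (cases x "0::real" rule: linorder_cases) auto
  then have "Im (Ln lam) = pi" using x assms(1) by (subst Im_Ln_eq_pi) auto
  then show ?thesis using that[of 1] assms(3) True by auto
next
  case False
  then have "Im lam \<noteq> 0" by (simp add: complex_is_Real_iff)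
  then consider "Im lam > 0" | "Im lam < 0" by linarith
  then show ?thesis
  proof cases
    case 1
    then show ?thesis using that[of 1] assms(3) False Im_Ln_pos_lt[OF assms(1)] by auto
  next
    case 2
    then have "Im (Ln lam) < 0" "- pi < Im (Ln lam)"
      using Im_Ln_pos_le[OF assms(1)] Im_Ln_le_pi[OF assms(1)] mpi_less_Im_Ln[OF assms(1)] by auto
    then show ?thesis using that[of "-1"] assms(3) False 2 by auto
  qed
qed

section \<open>Convergence of the quotients\<close>

theorem proposition8:
  fixes lam :: complex and eps :: real and K :: "complex set"
  assumes "lam \<noteq> 0" and "lam \<notin> complex_of_real ` {0<..}"
    and "eps = (if lam \<in> \<real> then 1 else sgn (Im lam))"
    and "compact K"
  shows "(\<forall>\<^sub>F n in sequentially. \<forall>z\<in>K. beta_ab n z lam \<noteq> 1)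
    \<and> (\<exists>C. \<forall>\<^sub>F n in sequentially. \<forall>z\<in>K.
          norm ((beta_ab (n + 1) z lam - 1) / (beta_ab n z lam - 1)
                - 1 / (1 - of_real eps * (2 * of_real pi * \<i> / Ln lam)))
          \<le> C * norm ((1 - of_real eps * (2 * of_real pi * \<i> / Ln lam))
                       / (1 + of_real eps * (2 * of_real pi * \<i> / Ln lam))) ^ n)
    \<and> uniform_limit K
          (\<lambda>n z. (beta_ab (n + 1) z lam - 1) / (beta_ab n z lam - 1))
          (\<lambda>z. 1 / (1 - of_real eps * (2 * of_real pi * \<i> / Ln lam)))
          sequentially"
proof -
  have lam: "lam \<noteq> 0" "lam \<noteq> 1"
    using assms(1,2) by (auto simp: image_iff)
  obtain e :: int where e: "e = 1 \<or> e = -1" "eps = of_int e"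
    "0 < e * Im (Ln lam)" "e * Im (Ln lam) \<le> pi"
    using sign_Im_Ln[OF assms(1-3)] by metis
  define t where "t = e * Im (Ln lam)"
  have t: "0 < t" "t \<le> pi" using e(3,4) by (auto simp: t_def)
  define N where "N y = sqrt (Re (Ln lam) ^ 2 + y ^ 2)" for y
  have N_le: "N x \<le> N y \<longleftrightarrow> \<bar>x\<bar> \<le> \<bar>y\<bar>" for x y
    by (simp add: N_def flip: abs_le_square_iff)
  have N_less: "N x < N y \<longleftrightarrow> \<bar>x\<bar> < \<bar>y\<bar>" for x y
    using N_le[of y x] by linarith
  have N_pos: "0 < N y" if "y \<noteq> 0" for y
    using that by (simp add: N_def add_nonneg_pos)
  have pole: "norm (ab_pole lam (e * j)) = N (2 * pi * j - t)" for j
    using norm_ab_pole[OF e(1)] by (simp add: N_def t_def)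
  \<comment> \<open>The heights for \<open>j = -2, -1, 0, 1, 2, 3\<close> are \<open>4 pi + t, 2 pi + t, t, 2 pi - t, 4 pi - t, 6 pi - t\<close>.
    Those for \<open>-1, 0, 1, 2\<close> are below \<open>4 pi\<close>, all others are at least \<open>4 pi + t\<close>. The circle has to
    enclose \<open>j = 2\<close> as well, because for \<open>t = pi\<close> that pole is as close to 0 as \<open>j = -1\<close>.\<close>
  define r where "r = N (4 * pi)"
  define r' where "r' = N (4 * pi + t)"
  define S where "S = (\<lambda>j. e * j) ` {-1, 0, 1, 2}"
  have r: "0 < r" "r < r'"
    using t by (auto simp: r_def r'_def N_less intro!: N_pos)
  have fin: "finite S" by (simp add: S_def)
  have inside: "norm (ab_pole lam k) < r" if "k \<in> S" for k
  proof -
    from that obtain j where j: "k = e * j" "j \<in> {-1, 0, 1, 2}" by (unfold S_def) blast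
    then have "\<bar>2 * pi * j - t\<bar> < \<bar>4 * pi\<bar>" using t by (auto simp: abs_if)
    then show ?thesis unfolding j(1) pole r_def N_less .
  qed
  have outside: "r' \<le> norm (ab_pole lam k)" if "k \<notin> S" for k
  proof -
    define j where "j = e * k"
    have k: "k = e * j" using e(1) by (auto simp: j_def)
    have "j \<notin> {-1, 0, 1, 2}" using that unfolding k S_def by blast
    then have "j \<le> -2 \<or> j \<ge> 3" by auto
    then have "\<bar>4 * pi + t\<bar> \<le> \<bar>2 * pi * j - t\<bar>"
    proof
      assume "j \<le> -2"
      then have "2 * pi * j \<le> 2 * pi * (-2)" by (intro mult_left_mono) auto
      then show ?thesis using t by linarith
    next
      assume "j \<ge> 3"
      then have "2 * pi * j \<ge> 2 * pi * 3" by (intro mult_left_mono) auto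
      then show ?thesis using t by linarith
    qed
    then show ?thesis unfolding k pole r'_def N_le .
  qed
  define q where "q j = ab_ratio lam (e * j)" for j
  define u where "u j z = exp (of_int (e * j) * (2 * of_real pi * \<i>) * z)" for j and z :: complex
  have L0: "Ln lam \<noteq> 0" using lam by (metis exp_Ln exp_zero)
  have norm_q: "norm (q j) = norm (Ln lam) / N (2 * pi * j - t)" for j
    by (simp add: q_def ab_ratio_eq[OF lam] norm_divide pole)
  have Npole: "N (2 * pi * j - t) > 0" for j :: int
    unfolding pole[symmetric] using ab_pole_nonzero[OF lam] by simp
  have q_less: "norm (q (-1)) < norm (q 1)"
    unfolding norm_q using L0 t
    by (intro divide_strict_left_mono mult_pos_pos Npole) (auto simp: N_less abs_if)
  have q1_pos: "0 < norm (q 1)" using q_less norm_ge_zero[of "q (-1)"] by linarith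
  have q2: "norm (q 2) \<le> norm (q (-1))"
    unfolding norm_q using t
    by (intro divide_left_mono mult_pos_pos Npole) (auto simp: N_le abs_if)
  have qr: "norm (Ln lam) / r \<le> norm (q (-1))"
    unfolding norm_q r_def using t
    by (intro divide_left_mono mult_pos_pos Npole N_pos) (auto simp: N_le abs_if)
  obtain X where X: "\<And>z. z \<in> K \<Longrightarrow> norm z \<le> X"
    using compact_imp_bounded[OF assms(4)] by (auto simp: bounded_iff)
  have u_le: "norm (u j z) \<le> exp (2 * pi * \<bar>of_int j\<bar> * X)" if "z \<in> K" for j z
  proof -
    have "norm (u j z) \<le> exp (norm (of_int (e * j) * (2 * of_real pi * \<i>) * z))"
      unfolding u_def by (rule norm_exp)
    also have "norm (of_int (e * j) * (2 * of_real pi * \<i>) * z) = 2 * pi * \<bar>of_int j\<bar> * norm z"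
      using e(1) by (auto simp: norm_mult)
    also have "exp \<dots> \<le> exp (2 * pi * \<bar>of_int j\<bar> * X)"
      using X that by (simp add: mult_left_mono)
    finally show ?thesis .
  qed
  \<comment> \<open>The upper bound for \<open>u (-1)\<close> is a lower bound for its reciprocal \<open>u 1\<close>.\<close>
  have u1: "exp (- (2 * pi * X)) \<le> norm (u 1 z)" if "z \<in> K" for z
  proof -
    have "u 1 z * u (-1) z = 1" by (simp add: u_def flip: exp_add)
    then have "norm (u 1 z) * norm (u (-1) z) = 1" by (metis norm_mult norm_one)
    moreover have "norm (u 1 z) * norm (u (-1) z) \<le> norm (u 1 z) * exp (2 * pi * X)"
      using u_le[OF that, of "-1"] by (intro mult_left_mono) auto
    ultimately show ?thesis by (simp add: exp_minus field_simps)
  qed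
  obtain C where C: "C \<ge> 0" "\<forall>n. \<forall>z\<in>K.
           norm (beta_ab n z lam
             - (\<Sum>k\<in>S. exp (of_int k * (2 * of_real pi * \<i>) * z) * ab_ratio lam k ^ n))
           \<le> C * (norm (Ln lam) / r) ^ n"
    using beta_ab_expansion[OF lam r fin inside outside compact_imp_bounded[OF assms(4)]] by blast
  have sum: "(\<Sum>k\<in>S. exp (of_int k * (2 * of_real pi * \<i>) * z) * ab_ratio lam k ^ n)
      = u (-1) z * q (-1) ^ n + 1 + u 1 z * q 1 ^ n + u 2 z * q 2 ^ n" for z n
  proof -
    have "inj_on (\<lambda>j. e * j) {-1, 0, 1, 2}" using e(1) by (auto simp: inj_on_def)
    then have "(\<Sum>k\<in>S. exp (of_int k * (2 * of_real pi * \<i>) * z) * ab_ratio lam k ^ n)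
        = (\<Sum>j\<in>{-1, 0, 1, 2}. u j z * q j ^ n)"
      unfolding S_def by (subst sum.reindex) (auto simp: u_def q_def)
    also have "u 0 z * q 0 ^ n = 1" by (simp add: u_def q_def ab_ratio_def)
    then have "(\<Sum>j\<in>{-1, 0, 1, 2}. u j z * q j ^ n)
        = u (-1) z * q (-1) ^ n + 1 + u 1 z * q 1 ^ n + u 2 z * q 2 ^ n" by simp
    finally show ?thesis .
  qed
  define D where "D = C + exp (2 * pi * X) + exp (4 * pi * X)"
  have D: "D \<ge> 0" using C(1) by (simp add: D_def)
  have rem: "norm ((beta_ab n z lam - 1) - u 1 z * q 1 ^ n) \<le> D * norm (q (-1)) ^ n"
    if z: "z \<in> K" for n z
  proof -
    let ?E = "beta_ab n z lam
             - (\<Sum>k\<in>S. exp (of_int k * (2 * of_real pi * \<i>) * z) * ab_ratio lam k ^ n)"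
    have "(beta_ab n z lam - 1) - u 1 z * q 1 ^ n = ?E + u (-1) z * q (-1) ^ n + u 2 z * q 2 ^ n"
      unfolding sum by simp
    also have "norm \<dots> \<le> norm ?E + norm (u (-1) z * q (-1) ^ n) + norm (u 2 z * q 2 ^ n)"
      by (intro norm_triangle_le add_mono order_refl norm_triangle_ineq)
    also have "\<dots> \<le> C * norm (q (-1)) ^ n + exp (2 * pi * X) * norm (q (-1)) ^ n
        + exp (4 * pi * X) * norm (q (-1)) ^ n"
    proof (intro add_mono)
      have "norm ?E \<le> C * (norm (Ln lam) / r) ^ n" by (rule C(2)[rule_format, OF z])
      also have "\<dots> \<le> C * norm (q (-1)) ^ n"
        using qr r C(1) by (intro mult_left_mono power_mono) auto
      finally show "norm ?E \<le> C * norm (q (-1)) ^ n" .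
      show "norm (u (-1) z * q (-1) ^ n) \<le> exp (2 * pi * X) * norm (q (-1)) ^ n"
        using u_le[OF z, of "-1"] by (simp add: norm_mult norm_power mult_right_mono)
      show "norm (u 2 z * q 2 ^ n) \<le> exp (4 * pi * X) * norm (q (-1)) ^ n"
        unfolding norm_mult norm_power
        using u_le[OF z, of 2] q2 by (intro mult_mono power_mono) auto
    qed
    also have "\<dots> = D * norm (q (-1)) ^ n" by (simp add: D_def algebra_simps)
    finally show ?thesis .
  qed
  note ratio = dominant_geometric_term_ratio[where f = "\<lambda>n z. beta_ab n z lam - 1",
      OF norm_ge_zero q_less exp_gt_zero u1 D rem, of K]
  have q1_eq: "q 1 = 1 / (1 - of_real eps * (2 * of_real pi * \<i> / Ln lam))"
    by (simp add: q_def ab_ratio_def e(2))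
  have rate: "norm (q (-1)) / norm (q 1)
      = norm ((1 - of_real eps * (2 * of_real pi * \<i> / Ln lam))
            / (1 + of_real eps * (2 * of_real pi * \<i> / Ln lam)))"
    by (simp add: q_def ab_ratio_def e(2) norm_divide)
  obtain B where B: "\<forall>\<^sub>F n in sequentially. \<forall>z\<in>K.
      norm ((beta_ab (n + 1) z lam - 1) / (beta_ab n z lam - 1) - q 1)
        \<le> B * (norm (q (-1)) / norm (q 1)) ^ n"
    using ratio(2) by auto
  have lim: "uniform_limit K (\<lambda>n z. (beta_ab (n + 1) z lam - 1) / (beta_ab n z lam - 1))
      (\<lambda>z. q 1) sequentially"
  proof (rule uniform_limitI)
    fix d :: real assume d: "0 < d"
    have "(\<lambda>n. B * (norm (q (-1)) / norm (q 1)) ^ n) \<longlonglongrightarrow> B * 0"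
      using q_less q1_pos by (intro tendsto_intros LIMSEQ_realpow_zero) auto
    then have "\<forall>\<^sub>F n in sequentially. B * (norm (q (-1)) / norm (q 1)) ^ n < d"
      using d by (intro order_tendstoD) auto
    with B show "\<forall>\<^sub>F n in sequentially. \<forall>z\<in>K.
        dist ((beta_ab (n + 1) z lam - 1) / (beta_ab n z lam - 1)) (q 1) < d"
      by eventually_elim (auto simp: dist_norm intro: le_less_trans)
  qed
  show ?thesis
    using ratio(1) B lim unfolding q1_eq[symmetric] rate[symmetric] by auto
qed

end
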